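(* Let $m>2$ be an integer and let $\theta_1\ge\theta_2\ge\theta_3$ be the roots of $x^3+(3-m)x^2+(2-2m)x-2$. Then $$\theta_1 > m-2 > 0 > \theta_2 > -1 > \theta_3,$$ and the spectrum of the complete bridge graph $B_{m,m-1}$ is $$\mathrm{Spec}(B_{m,m-1}) = \begin{pmatrix}\theta_1 & m-2 & \theta_2 & -1 & \theta_3\\ 1 & 1 & 1 & 2m-5 & 1\end{pmatrix}.$$
   Context: The complete bridge graph $B_{m,n}$ is the graph on $m+n$ vertices consisting of two vertex-disjoint complete graphs $K_m$ and $K_n$ joined by exactly one additional edge (between one vertex of $K_m$ and one vertex of $K_n$). $\mathrm{Spec}(\Gamma)$ denotes the adjacency spectrum of the graph $\Gamma$, written as a two-row array: the first row lists the distinct eigenvalues of the adjacency matrix of $\Gamma$, and the second row lists their multiplicities. *)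

theory Defs
  imports "Graph_Theory.Graph_Theory" "Jordan_Normal_Form.Spectral_Radius"
begin

text \<open>
  Simple graphs are loop-free symmetric digraphs (locale \<open>pair_graph\<close>).  In \<open>complete_bridge m n\<close>
  the complete graphs live on \<open>{0..<m}\<close> and \<open>{m..<m + n}\<close>, and the bridge joins \<open>m - 1\<close> to \<open>m\<close>;
  every choice of the two end vertices gives an isomorphic graph.  The definition is meant
  for \<open>m, n \<ge> 1\<close>, since otherwise there is no possible bridge.
\<close>

definition complete_bridge :: "nat \<Rightarrow> nat \<Rightarrow> nat pair_pre_digraph" where
  "complete_bridge m n =
     \<lparr> pverts = {0..<m + n},
       parcs = {(u, v). u \<in> {0..<m} \<and> v \<in> {0..<m} \<and> u \<noteq> v}
             \<union> {(u, v). u \<in> {m..<m + n} \<and> v \<in> {m..<m + n} \<and> u \<noteq> v}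
             \<union> {(m - 1, m), (m, m - 1)} \<rparr>"

lemma pair_graph_complete_bridge:
  assumes "m \<ge> 1" "n \<ge> 1"
  shows "pair_graph (complete_bridge m n)"
proof -
  have "parcs (complete_bridge m n) \<subseteq> {0..<m + n} \<times> {0..<m + n}"
    using assms by (auto simp: complete_bridge_def)
  then have "finite (parcs (complete_bridge m n))"
    by (rule finite_subset) simp
  then show ?thesis
    using assms
    by unfold_locales
       (auto simp: complete_bridge_def symmetric_def arcs_ends_conv sym_def)
qed

lemma complete_bridge_induced:
  assumes "m \<ge> 1" "n \<ge> 1"
  shows "K\<^bsub>m\<^esub> (with_proj (complete_bridge m n) \<restriction> {0..<m})"
    and "K\<^bsub>n\<^esub> (with_proj (complete_bridge m n) \<restriction> {m..<m + n})"
proof -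
  have "with_proj (complete_bridge m n) \<restriction> {0..<m} =
        with_proj \<lparr> pverts = {0..<m}, parcs = {(u, v). (u, v) \<in> {0..<m} \<times> {0..<m} \<and> u \<noteq> v} \<rparr>"
    using assms by (auto simp: complete_bridge_def with_proj_def induce_subgraph_def)
  then show "K\<^bsub>m\<^esub> (with_proj (complete_bridge m n) \<restriction> {0..<m})"
    by (simp only: complete_digraph_pair_def) simp
  have "with_proj (complete_bridge m n) \<restriction> {m..<m + n} =
        with_proj \<lparr> pverts = {m..<m + n}, parcs = {(u, v). (u, v) \<in> {m..<m + n} \<times> {m..<m + n} \<and> u \<noteq> v} \<rparr>"
    using assms by (auto simp: complete_bridge_def with_proj_def induce_subgraph_def)
  then show "K\<^bsub>n\<^esub> (with_proj (complete_bridge m n) \<restriction> {m..<m + n})"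
    by (simp only: complete_digraph_pair_def) simp
qed

text \<open>Rows and columns are indexed by the vertices in increasing order.\<close>

definition adjacency_matrix :: "'a::linorder pair_pre_digraph \<Rightarrow> real mat" where
  "adjacency_matrix G =
     (let vs = sorted_list_of_set (pverts G); k = length vs
      in mat k k (\<lambda>(i, j). if (vs ! i, vs ! j) \<in> parcs G then 1 else 0))"

text \<open>
  The two-row array of a graph, as the list of its columns (eigenvalue, multiplicity), the
  eigenvalues being listed once each in decreasing order.  The multiplicity is that of
  the root of the characteristic polynomial.  Since the adjacency matrix of
  a graph is real symmetric, this is also the dimension of the eigenspace, and no
  eigenvalue is lost by working over the reals.
\<close>

definition graph_Spec :: "'a::linorder pair_pre_digraph \<Rightarrow> (real \<times> nat) list" where
  "graph_Spec G =
     map (\<lambda>x. (x, Polynomial.order x (char_poly (adjacency_matrix G))))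
         (rev (sorted_list_of_set (spectrum (adjacency_matrix G))))"

text \<open>The roots are counted with multiplicity, so for a cubic \<open>p\<close> these are all the complex roots.\<close>

definition roots_desc :: "real poly \<Rightarrow> real \<Rightarrow> real \<Rightarrow> real \<Rightarrow> bool" where
  "roots_desc p a b c \<longleftrightarrow> proots p = {#a, b, c#} \<and> a \<ge> b \<and> b \<ge> c"

end

theory Submission
  imports Defs
begin

text \<open>
  Adding the identity to the adjacency matrix of \<open>complete_bridge m n\<close> gives a matrix of rank at
  most \<open>4\<close>: with \<open>P\<close> and \<open>Q\<close> the vertex sets of the two complete graphs and \<open>s\<close>, \<open>t\<close> the ends of
  the bridge, it is \<open>1\<^sub>P 1\<^sub>P\<^sup>T + 1\<^sub>Q 1\<^sub>Q\<^sup>T + e\<^sub>s e\<^sub>t\<^sup>T + e\<^sub>t e\<^sub>s\<^sup>T\<close>, that is, \<open>C B\<close> with \<open>C\<close> having the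
  columns \<open>1\<^sub>P, 1\<^sub>Q, e\<^sub>s, e\<^sub>t\<close> and \<open>B\<close> the rows \<open>1\<^sub>P\<^sup>T, 1\<^sub>Q\<^sup>T, e\<^sub>t\<^sup>T, e\<^sub>s\<^sup>T\<close>.  By Sylvester's identity
  (\<open>det_smult_one_diff_mult_commute\<close>) its characteristic polynomial in \<open>y = x + 1\<close> is, up to a
  power of \<open>y\<close>, that of the \<open>4 \<times> 4\<close> matrix \<open>B C\<close>, whose entries are sizes of intersections of the
  sets involved.  This is \<open>char_poly_complete_bridge\<close>.

  For \<open>n = m - 1\<close> the quartic factor contains \<open>x - (m - 2)\<close>, and the quotient is the cubic of the
  theorem, so the characteristic polynomial is \<open>(x + 1)\<^bsup>2m-5\<^esup> (x - (m - 2)) p(x)\<close>.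
  The cubic is \<open>p(x) = (x + 1)\<^sup>2 (x - m + 1) - (x - m + 3)\<close>, from which its signs at \<open>-1\<close>, \<open>0\<close> and
  \<open>m - 2\<close> can be read off; the intermediate value theorem then separates its roots from each other
  and from \<open>-1\<close> and \<open>m - 2\<close> (\<open>bridge_cubic_roots\<close>).  Hence the five listed eigenvalues are distinct
  and the multiplicities are the visible exponents.
\<close>

section \<open>A Sylvester identity for determinants\<close>

text \<open>
  Both sides compute \<open>y\<^sup>k\<close> times the determinant of the block matrix with rows \<open>(1, B)\<close> and
  \<open>(A, y)\<close>.  Clearing the block \<open>A\<close> by a multiplication from the left leaves the Schur complement
  \<open>y - A B\<close>; clearing it from the right leaves \<open>y - B A\<close>, at the price of a factor \<open>y\<^sup>k\<close>,
  because no division by \<open>y\<close> is possible in the ring.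
\<close>

lemma det_smult_one_diff_mult_commute:
  fixes A B :: "'a::idom mat"
  assumes A: "A \<in> carrier_mat n k" and B: "B \<in> carrier_mat k n"
  shows "y ^ k * det (y \<cdot>\<^sub>m 1\<^sub>m n - A * B) = y ^ n * det (y \<cdot>\<^sub>m 1\<^sub>m k - B * A)"
proof -
  let ?M = "four_block_mat (1\<^sub>m k) B A (y \<cdot>\<^sub>m 1\<^sub>m n)"
  let ?L = "four_block_mat (1\<^sub>m k) (0\<^sub>m k n) (- A) (1\<^sub>m n)"
  let ?R = "four_block_mat (y \<cdot>\<^sub>m 1\<^sub>m k) (0\<^sub>m k n) (- A) (1\<^sub>m n)"
  have M: "?M \<in> carrier_mat (k + n) (k + n)"
    and L: "?L \<in> carrier_mat (k + n) (k + n)"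
    and R: "?R \<in> carrier_mat (k + n) (k + n)"
    by auto
  have mA: "- A \<in> carrier_mat n k" using A by simp
  have yk: "y \<cdot>\<^sub>m 1\<^sub>m k \<in> carrier_mat k k" and yn: "y \<cdot>\<^sub>m 1\<^sub>m n \<in> carrier_mat n n"
    by auto
  have negAB: "(- A) * B = - (A * B)" using A B by (intro eq_matI) auto
  have negBA: "B * (- A) = - (B * A)" using A B by (intro eq_matI) auto
  have "?L * ?M = four_block_mat (1\<^sub>m k * 1\<^sub>m k + 0\<^sub>m k n * A) (1\<^sub>m k * B + 0\<^sub>m k n * (y \<cdot>\<^sub>m 1\<^sub>m n))
      ((- A) * 1\<^sub>m k + 1\<^sub>m n * A) ((- A) * B + 1\<^sub>m n * (y \<cdot>\<^sub>m 1\<^sub>m n))"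
    by (rule mult_four_block_mat) (use A B mA in auto)
  also have "\<dots> = four_block_mat (1\<^sub>m k) B (0\<^sub>m n k) (y \<cdot>\<^sub>m 1\<^sub>m n - A * B)"
    unfolding negAB by (rule cong_four_block_mat; (intro eq_matI)?) (use A B in auto)
  finally have LM: "?L * ?M = four_block_mat (1\<^sub>m k) B (0\<^sub>m n k) (y \<cdot>\<^sub>m 1\<^sub>m n - A * B)" .
  have "?M * ?R = four_block_mat (1\<^sub>m k * (y \<cdot>\<^sub>m 1\<^sub>m k) + B * (- A)) (1\<^sub>m k * 0\<^sub>m k n + B * 1\<^sub>m n)
      (A * (y \<cdot>\<^sub>m 1\<^sub>m k) + (y \<cdot>\<^sub>m 1\<^sub>m n) * (- A)) (A * 0\<^sub>m k n + (y \<cdot>\<^sub>m 1\<^sub>m n) * 1\<^sub>m n)"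
    by (rule mult_four_block_mat) (use A B mA in auto)
  also have "\<dots> = four_block_mat (y \<cdot>\<^sub>m 1\<^sub>m k - B * A) B (0\<^sub>m n k) (y \<cdot>\<^sub>m 1\<^sub>m n)"
  proof (rule cong_four_block_mat)
    have "A * (y \<cdot>\<^sub>m 1\<^sub>m k) = y \<cdot>\<^sub>m A"
      using A mult_smult_distrib[OF A one_carrier_mat, of y] by simp
    moreover have "(y \<cdot>\<^sub>m 1\<^sub>m n) * (- A) = y \<cdot>\<^sub>m (- A)"
      using mA mult_smult_assoc_mat[OF one_carrier_mat mA, of y] by simp
    ultimately show "A * (y \<cdot>\<^sub>m 1\<^sub>m k) + (y \<cdot>\<^sub>m 1\<^sub>m n) * (- A) = 0\<^sub>m n k"
      using A by (intro eq_matI) auto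
    show "1\<^sub>m k * (y \<cdot>\<^sub>m 1\<^sub>m k) + B * (- A) = y \<cdot>\<^sub>m 1\<^sub>m k - B * A"
      unfolding negBA using A B by (intro eq_matI) auto
  qed (use A B in auto)
  finally have MR: "?M * ?R = four_block_mat (y \<cdot>\<^sub>m 1\<^sub>m k - B * A) B (0\<^sub>m n k) (y \<cdot>\<^sub>m 1\<^sub>m n)" .
  have "det ?L = 1"
    by (subst det_four_block_mat_upper_right_zero) (use A in auto)
  then have "det ?M = det (?L * ?M)"
    by (simp add: det_mult[OF L M])
  also have "\<dots> = det (y \<cdot>\<^sub>m 1\<^sub>m n - A * B)"
    unfolding LM by (subst det_four_block_mat_lower_left_zero) (use A B in auto)
  finally have 1: "det ?M = det (y \<cdot>\<^sub>m 1\<^sub>m n - A * B)" .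
  have "det ?R = y ^ k"
    by (subst det_four_block_mat_upper_right_zero) (use A in auto)
  then have "det ?M * y ^ k = det (?M * ?R)"
    by (simp add: det_mult[OF M R])
  also have "\<dots> = det (y \<cdot>\<^sub>m 1\<^sub>m k - B * A) * y ^ n"
    unfolding MR by (subst det_four_block_mat_lower_left_zero) (use A B in auto)
  finally show ?thesis
    unfolding 1 by (simp add: mult.commute)
qed

section \<open>The characteristic polynomial of a complete bridge graph\<close>

lemma det_2_by_2:
  fixes A :: "'a::comm_ring_1 mat"
  assumes "A \<in> carrier_mat 2 2"
  shows "det A = A $$ (0, 0) * A $$ (1, 1) - A $$ (0, 1) * A $$ (1, 0)"
  using assms
  by (subst laplace_expansion_row[of A 2 0])
     (auto simp: cofactor_def mat_delete_def det_single numeral_2_eq_2)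

lemma indicator_mat_mult:
  fixes S T :: "nat \<Rightarrow> nat set"
  shows "mat k n (\<lambda>(j, i). of_bool (i \<in> T j)) * mat n l (\<lambda>(i, j). of_bool (i \<in> S j)) =
    (mat k l (\<lambda>(i, j). of_nat (card (T i \<inter> S j \<inter> {0..<n}))) :: 'a::comm_ring_1 mat)"
proof -
  have "(\<Sum>x = 0..<n. of_bool (x \<in> T i) * of_bool (x \<in> S j)) =
      (of_nat (card (T i \<inter> S j \<inter> {0..<n})) :: 'a)" for i j
  proof -
    have "(\<Sum>x = 0..<n. of_bool (x \<in> T i) * of_bool (x \<in> S j)) =
        (\<Sum>x = 0..<n. if x \<in> T i \<inter> S j then 1 else (0::'a))"
      by (rule sum.cong) auto
    also have "\<dots> = of_nat (card (T i \<inter> S j \<inter> {0..<n}))"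
      by (simp add: sum.If_cases Int_commute flip: Int_def)
    finally show ?thesis .
  qed
  then show ?thesis
    by (intro eq_matI) (auto simp: scalar_prod_def)
qed

lemma adjacency_matrix_complete_bridge:
  "adjacency_matrix (complete_bridge m n) =
     mat (m + n) (m + n) (\<lambda>(i, j). if (i, j) \<in> parcs (complete_bridge m n) then 1 else 0)"
  by (intro eq_matI) (auto simp: adjacency_matrix_def Let_def complete_bridge_def)

text \<open>
  With \<open>m, n\<close> for \<open>a, b\<close> the matrix is \<open>y - B C\<close> for the bridge graph.  Its two lower \<open>2 \<times> 2\<close> blocks are
  polynomials in the swap matrix, so they commute and the determinant reduces to size \<open>2\<close>.
\<close>

lemma det_bridge_quotient:
  fixes y a b :: "'a::idom"
  shows "det (mat 4 4 (\<lambda>(i, j). [[y - a, 0, -1, 0], [0, y - b, 0, -1],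
      [0, -1, y, -1], [-1, 0, -1, y]] ! i ! j)) =
    y\<^sup>2 * (y - a) * (y - b) - (y - a + 1) * (y - b + 1)" (is "det ?M = _")
proof -
  let ?mk = "\<lambda>p q r s. mat 2 2 (\<lambda>(i, j). [[p, q], [r, s]] ! i ! j) :: 'a mat"
  let ?A = "?mk (y - a) 0 0 (y - b)" and ?B = "?mk (-1) 0 0 (-1)"
    and ?C = "?mk 0 (-1) (-1) 0" and ?D = "?mk y (-1) (-1) y"
  have mult: "?mk p q r s * ?mk p' q' r' s' =
      ?mk (p * p' + q * r') (p * q' + q * s') (r * p' + s * r') (r * q' + s * s')"
    for p q r s p' q' r' s'
    by (intro eq_matI) (auto simp: scalar_prod_def numeral_2_eq_2 less_Suc_eq)
  have "?M = four_block_mat ?A ?B ?C ?D"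
    by (intro eq_matI) (auto simp: eval_nat_numeral less_Suc_eq)
  moreover have "?C * ?D = ?D * ?C"
    unfolding mult by simp
  ultimately have "det ?M = det (?A * ?D - ?B * ?C)"
    using det_four_block_mat[of ?A 2 ?B ?C ?D] by simp
  also have "\<dots> = y\<^sup>2 * (y - a) * (y - b) - (y - a + 1) * (y - b + 1)"
    unfolding mult
    by (subst det_2_by_2) (auto simp: algebra_simps power2_eq_square)
  finally show ?thesis .
qed

text \<open>
  In terms of complete graphs this reads
  \<open>\<phi>(K\<^sub>m) \<phi>(K\<^sub>n) - \<phi>(K\<^bsub>m-1\<^esub>) \<phi>(K\<^bsub>n-1\<^esub>)\<close>, the usual effect of a bridge on the characteristic
  polynomial \<open>\<phi>\<close>; the bound on \<open>m\<close> and \<open>n\<close> makes \<open>m + n - 4\<close> a true difference.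
\<close>

lemma char_poly_complete_bridge:
  assumes "m \<ge> 2" "n \<ge> 2"
  shows "char_poly (adjacency_matrix (complete_bridge m n)) =
    [:1, 1:] ^ (m + n - 4) *
    ([:1, 1:]\<^sup>2 * [:1 - real m, 1:] * [:1 - real n, 1:] - [:2 - real m, 1:] * [:2 - real n, 1:])"
proof -
  let ?N = "m + n"
  let ?y = "[:1, 1:] :: real poly"
  \<comment> \<open>Column \<open>j\<close> of \<open>C\<close> is the indicator of \<open>S j\<close> and row \<open>j\<close> of \<open>B\<close> that of \<open>T j\<close>; the two ends of
    the bridge are exchanged in \<open>T\<close>, which puts the bridge arcs off the diagonal of \<open>C B\<close>.\<close>
  define S where "S = (\<lambda>j. [{0..<m}, {m..<?N}, {m - 1}, {m}] ! j)"
  define T where "T = (\<lambda>j. [{0..<m}, {m..<?N}, {m}, {m - 1}] ! j)"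
  define C :: "real poly mat" where "C = mat ?N 4 (\<lambda>(i, j). of_bool (i \<in> S j))"
  define B :: "real poly mat" where "B = mat 4 ?N (\<lambda>(j, i). of_bool (i \<in> T j))"
  have carrier: "C \<in> carrier_mat ?N 4" "B \<in> carrier_mat 4 ?N"
    by (auto simp: C_def B_def)
  have CB: "(C * B) $$ (i, j) = (if i = j then 1 else 0) +
      (if (i, j) \<in> parcs (complete_bridge m n) then 1 else 0)" if "i < ?N" "j < ?N" for i j
    using that assms
    by (auto simp: C_def B_def S_def T_def scalar_prod_def eval_nat_numeral complete_bridge_def)
  have "char_poly_matrix (adjacency_matrix (complete_bridge m n)) = ?y \<cdot>\<^sub>m 1\<^sub>m ?N - C * B"
    using carrier CB
    by (intro eq_matI)
       (auto simp: char_poly_matrix_def adjacency_matrix_complete_bridge one_pCons)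
  then have 1: "char_poly (adjacency_matrix (complete_bridge m n)) = det (?y \<cdot>\<^sub>m 1\<^sub>m ?N - C * B)"
    by (simp add: char_poly_def)
  have BC: "B * C = mat 4 4 (\<lambda>(i, j). of_nat (card (T i \<inter> S j \<inter> {0..<?N})))"
    unfolding B_def C_def by (rule indicator_mat_mult)
  have sets: "{x. x < m \<and> x < ?N} = {0..<m}" "{x. m \<le> x \<and> x < ?N} = {m..<?N}"
    "{x. x = m - Suc 0 \<and> x < m \<and> x < ?N} = {m - Suc 0}" "{x. x = m \<and> m \<le> x \<and> x < ?N} = {m}"
    "{x. x = m - Suc 0 \<and> x < ?N} = {m - Suc 0}" "{x. x = m \<and> x < ?N} = {m}"
    using assms by auto
  have "?y \<cdot>\<^sub>m 1\<^sub>m 4 - B * C = mat 4 4 (\<lambda>(i, j).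
      [[?y - of_nat m, 0, -1, 0], [0, ?y - of_nat n, 0, -1], [0, -1, ?y, -1], [-1, 0, -1, ?y]] ! i ! j)"
    unfolding BC using assms
    by (intro eq_matI)
      (auto simp: S_def T_def eval_nat_numeral less_Suc_eq Int_def sets one_pCons)
  then have 2: "det (?y \<cdot>\<^sub>m 1\<^sub>m 4 - B * C) = 
     ?y\<^sup>2 * (?y - of_nat m) * (?y - of_nat n) - (?y - of_nat m + 1) * (?y - of_nat n + 1)"
    by (simp only: det_bridge_quotient)
  have "?y ^ 4 * det (?y \<cdot>\<^sub>m 1\<^sub>m ?N - C * B) = ?y ^ ?N * det (?y \<cdot>\<^sub>m 1\<^sub>m 4 - B * C)"
    by (rule det_smult_one_diff_mult_commute[OF carrier])
  also have "?y ^ ?N = ?y ^ 4 * ?y ^ (?N - 4)"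
    using assms by (simp flip: power_add)
  finally have "det (?y \<cdot>\<^sub>m 1\<^sub>m ?N - C * B) = ?y ^ (?N - 4) * det (?y \<cdot>\<^sub>m 1\<^sub>m 4 - B * C)"
    by (simp only: mult.assoc mult_cancel_left) simp
  then show ?thesis
    unfolding 1 2 by (simp add: of_nat_poly one_pCons algebra_simps)
qed

section \<open>Location of the roots of the cubic\<close>

text \<open>Three distinct roots leave no room in the degree for a further root or a multiplicity.\<close>

lemma roots_desc_distinct:
  assumes "degree p = 3" "poly p a = 0" "poly p b = 0" "poly p c = 0" "a > b" "b > c"
  shows "roots_desc p a b c"
proof -
  from assms(1) have "p \<noteq> 0" by auto
  have "{#a, b, c#} \<subseteq># proots p"
    using assms \<open>p \<noteq> 0\<close> 
    by (auto simp: subseteq_mset_def order_root Suc_le_eq)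
  moreover have "size (proots p) \<le> size {#a, b, c#}"
    using size_proots_le[of p] assms(1) by simp
  ultimately have "proots p = {#a, b, c#}"
    by (metis mset_subset_size not_le subset_mset.le_less)
  then show ?thesis
    using assms by (simp add: roots_desc_def)
qed

lemma roots_desc_unique:
  assumes "roots_desc p a b c" "roots_desc p a' b' c'"
  shows "a = a'" "b = b'" "c = c'"
  using assms unfolding roots_desc_def
  by (auto simp: add_eq_conv_ex)

lemma bridge_cubic_roots:
  fixes r :: real
  assumes "r > 2"
  obtains a b c where "roots_desc [:-2, 2 - 2 * r, 3 - r, 1:] a b c"
    "a > r - 2" "0 > b" "b > -1" "-1 > c"
proof -
  let ?p = "[:-2, 2 - 2 * r, 3 - r, 1:]"
  have eq: "poly ?p x = (x + 1)\<^sup>2 * (x - r + 1) - (x - r + 3)" for x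
    by (simp add: algebra_simps power2_eq_square)
  \<comment> \<open>The points \<open>-3\<close> and \<open>r\<close> bound the outer roots: there \<open>p\<close> already has the sign of its limit.\<close>
  have "r * r > 2 * r"
    using assms by simp
  then have "r * 2 < r * r + 2" "2 < r * r + r * 2"
    using assms by linarith+
  then have 1: "poly ?p (-1) > 0" "poly ?p 0 < 0" "poly ?p (r - 2) < 0" "poly ?p r > 0" "poly ?p (-3) < 0"
    unfolding eq using assms by (auto simp: algebra_simps power2_eq_square)
  obtain b where "-1 < b" "b < 0" "poly ?p b = 0"
    using poly_IVT_neg[of "-1" 0 ?p] 1 by auto
  moreover obtain a where "r - 2 < a" "poly ?p a = 0"
    using poly_IVT_pos[of "r - 2" r ?p] 1 by auto
  moreover obtain c where "c < -1" "poly ?p c = 0"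
    using poly_IVT_pos[of "-3" "-1" ?p] 1 by auto
  ultimately show ?thesis
    using assms by (intro that[of a b c] roots_desc_distinct) auto
qed

section \<open>The spectrum\<close>

theorem theorem3p8:
  fixes m :: nat
  assumes "m > 2"
  shows "let p = [:-2, 2 - 2 * real m, 3 - real m, 1:] in
    (\<exists>\<theta>\<^sub>1 \<theta>\<^sub>2 \<theta>\<^sub>3. roots_desc p \<theta>\<^sub>1 \<theta>\<^sub>2 \<theta>\<^sub>3) \<and>
    (\<forall>\<theta>\<^sub>1 \<theta>\<^sub>2 \<theta>\<^sub>3. roots_desc p \<theta>\<^sub>1 \<theta>\<^sub>2 \<theta>\<^sub>3 \<longrightarrow>
       \<theta>\<^sub>1 > real m - 2 \<and> real m - 2 > 0 \<and> 0 > \<theta>\<^sub>2 \<and> \<theta>\<^sub>2 > -1 \<and> -1 > \<theta>\<^sub>3 \<and>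
       graph_Spec (complete_bridge m (m - 1)) =
         [(\<theta>\<^sub>1, 1), (real m - 2, 1), (\<theta>\<^sub>2, 1), (-1, 2 * m - 5), (\<theta>\<^sub>3, 1)])"
proof -
  let ?p = "[:-2, 2 - 2 * real m, 3 - real m, 1:]"
  obtain a b c where abc: "roots_desc ?p a b c"
    and ineq: "a > real m - 2" "0 > b" "b > -1" "-1 > c"
    using bridge_cubic_roots[of "real m"] assms by auto
  let ?A = "adjacency_matrix (complete_bridge m (m - 1))"
  \<comment> \<open>For \<open>n = m - 1\<close> the factor \<open>x + 1 - n\<close> of the first product equals the factor \<open>x + 2 - m\<close> of
    the second, so it comes out of the difference.\<close>
  have char_poly: "char_poly ?A = [:1, 1:] ^ (2 * m - 5) * [:2 - real m, 1:] * ?p"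
  proof -
    have "m + (m - 1) - 4 = 2 * m - 5" by simp
    moreover have "[:1, 1:]\<^sup>2 * [:1 - real m, 1:] * [:1 - real (m - 1), 1:] -
        [:2 - real m, 1:] * [:2 - real (m - 1), 1:] = [:2 - real m, 1:] * ?p"
      using assms by (simp add: of_nat_diff power2_eq_square algebra_simps)
    ultimately show ?thesis
      using char_poly_complete_bridge[of m "m - 1"] assms by (simp only: mult.assoc)
  qed
  have nz: "char_poly ?A \<noteq> 0"
    unfolding char_poly by (simp del: mult_pCons_left mult_pCons_right)
  have "proots (char_poly ?A) = repeat_mset (2 * m - 5) {#-1#} + {#real m - 2#} + proots ?p"
    unfolding char_poly by (simp add: proots_mult proots_power del: mult_pCons_left mult_pCons_right)
  then have proots: "proots (char_poly ?A) =
      replicate_mset (2 * m - 5) (-1) + {#real m - 2#} + {#a, b, c#}"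
    using abc by (simp add: roots_desc_def)
  have order: "Polynomial.order x (char_poly ?A) =
      count (replicate_mset (2 * m - 5) (-1) + {#real m - 2#} + {#a, b, c#}) x" for x
    by (simp only: count_proots[OF nz] flip: proots)
  have "?A \<in> carrier_mat (m + (m - 1)) (m + (m - 1))"
    by (simp add: adjacency_matrix_complete_bridge)
  then have "spectrum ?A = set_mset (proots (char_poly ?A))"
    by (simp only: spectrum_root_char_poly set_count_proots[OF nz])
  also have "\<dots> = {c, -1, b, real m - 2, a}"
    unfolding proots using assms by auto
  also have "sorted_list_of_set \<dots> = [c, -1, b, real m - 2, a]"
    using ineq assms by (intro sorted_list_of_set_unique[THEN iffD1]) auto
  finally have "graph_Spec (complete_bridge m (m - 1)) =
      [(a, 1), (real m - 2, 1), (b, 1), (-1, 2 * m - 5), (c, 1)]"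
    unfolding graph_Spec_def order using ineq assms by simp
  with abc ineq assms show ?thesis
    unfolding Let_def by (auto dest: roots_desc_unique[OF abc])
qed

end
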